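(* For every $n \geq 4$, in any algorithm for the priority evacuation problem $PE_n$ (one queen and $n$ servants), the evacuation time of the queen is at least $$1 + \frac{2}{n}\cos^{-1}\left(-\frac{2}{n}\right) + \sqrt{1 - \frac{4}{n^2}}.$$ Moreover, as $n \to \infty$ this bound equals $2 + \frac{\pi}{n} + \frac{2}{n^2} + O(n^{-3})$.
   Context: Priority evacuation problem $PE_n$: $n+1$ mobile robots, one distinguished robot called the queen and $n$ robots called servants, all start at time $0$ at the center $O=(0,0)$ of the unit disk. Each robot moves with speed at most $1$. An exit is located at an unknown point of the unit circle $\mathcal{U}$ (the boundary of the disk); a robot discovers the exit when it walks over its location, and immediately and instantaneously broadcasts its position to all robots (wireless communication). An algorithm specifies the trajectories of all robots as functions of time for as long as the exit has not been found; once the exit is found, the queen moves to it. An algorithm solves $PE_n$ if, in finite time, every point of $\mathcal{U}$ is visited by at least one robot. The evacuation time of an algorithm is the worst case, over all possible exit positions on $\mathcal{U}$, of the time at which the queen reaches the exit. The queen may or may not participate in the search. *)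

theory Defs
  imports "HOL-Analysis.Analysis" "HOL-Library.Landau_Symbols"
begin

text \<open>
  The plane is modelled by the complex numbers, so the unit circle is \<^term>\<open>sphere (0::complex) 1\<close>.
  A trajectory describes the motion of a robot for as long as the exit has not been found;
  \<open>1\<close>-Lipschitz continuity expresses speed at most \<open>1\<close>.
\<close>

definition trajectory :: "(real \<Rightarrow> complex) \<Rightarrow> bool" where
  "trajectory f \<longleftrightarrow> f 0 = 0 \<and> 1-lipschitz_on {0..} f"

definition visits :: "(real \<Rightarrow> complex) \<Rightarrow> real \<Rightarrow> complex \<Rightarrow> bool" where
  "visits f t x \<longleftrightarrow> 0 \<le> t \<and> f t = x"

definition visited_at ::
    "nat \<Rightarrow> (real \<Rightarrow> complex) \<Rightarrow> (nat \<Rightarrow> real \<Rightarrow> complex) \<Rightarrow> real \<Rightarrow> complex \<Rightarrow> bool" where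
  "visited_at n queen servant t x \<longleftrightarrow>
     visits queen t x \<or> (\<exists>i<n. visits (servant i) t x)"

text \<open>An algorithm consists of the trajectory of the queen and those of the servants
  \<open>0, \<dots>, n - 1\<close>; the values of \<open>servant\<close> at other indices are irrelevant.\<close>

definition solves_PE :: "nat \<Rightarrow> (real \<Rightarrow> complex) \<Rightarrow> (nat \<Rightarrow> real \<Rightarrow> complex) \<Rightarrow> bool" where
  "solves_PE n queen servant \<longleftrightarrow>
     trajectory queen \<and> (\<forall>i<n. trajectory (servant i)) \<and>
     (\<exists>T. \<forall>x\<in>sphere 0 1. \<exists>t\<le>T. visited_at n queen servant t x)"

text \<open>For an algorithm that solves the problem, the infimum below is a minimum,
  since trajectories are continuous.\<close>

definition discovery_time ::
    "nat \<Rightarrow> (real \<Rightarrow> complex) \<Rightarrow> (nat \<Rightarrow> real \<Rightarrow> complex) \<Rightarrow> complex \<Rightarrow> real" where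
  "discovery_time n queen servant x = Inf {t. visited_at n queen servant t x}"

text \<open>From the moment of discovery on, the queen walks straight to the exit at full speed.\<close>

definition queen_arrival_time ::
    "nat \<Rightarrow> (real \<Rightarrow> complex) \<Rightarrow> (nat \<Rightarrow> real \<Rightarrow> complex) \<Rightarrow> complex \<Rightarrow> real" where
  "queen_arrival_time n queen servant x =
     (let t = discovery_time n queen servant x in t + dist (queen t) x)"

definition evacuation_time ::
    "nat \<Rightarrow> (real \<Rightarrow> complex) \<Rightarrow> (nat \<Rightarrow> real \<Rightarrow> complex) \<Rightarrow> ereal" where
  "evacuation_time n queen servant =
     (SUP x\<in>sphere 0 1. ereal (queen_arrival_time n queen servant x))"

end

theory Submission
  imports Defs "HOL-Real_Asymp.Real_Asymp"
begin

text \<open>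
  The part of the circle inside a disk of radius \<open>r < 1\<close> has length at most \<open>2 arcsin r\<close>. Applied to
  short time intervals, this shows that a servant explores length at most \<open>x\<close> up to time \<open>1 + x\<close>.
  Every point that is still unexplored at time \<open>1 + x\<close> must lie within \<open>T - 1 - x\<close> of the queen,
  where \<open>T\<close> is the evacuation time, so as long as the queen has not reached the circle, \<open>n x\<close> plus
  the length of the circle inside that disk is at least \<open>2 \<pi>\<close>.

  Let \<open>cos a = - 2 / n\<close> and \<open>X = 2 a / n\<close>. If the queen stays off the circle up to time \<open>1 + X\<close>, taking
  \<open>x = X\<close> gives \<open>T \<ge> 1 + X + sin a\<close>. If she first reaches the circle at time \<open>1 + x\<close> with \<open>x \<le> X\<close>,
  the disk is centred on the circle and \<open>T \<ge> 1 + x + 2 cos (n x / 4)\<close>; the right-hand side is concave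
  in \<open>x\<close>, so it suffices to compare it with \<open>1 + X + sin a\<close> at \<open>x = 0\<close>, where \<open>n \<ge> 4\<close> is used,
  and at \<open>x = X\<close>.
\<close>

section \<open>Arc length on the unit circle\<close>

text \<open>Arc length is pulled back to one period of angles. Points off the circle contribute
  nothing, so disks and images of trajectories can be measured directly.\<close>

definition circle_measure :: "complex set \<Rightarrow> real" where
  "circle_measure A = measure lborel ({0..<2*pi} \<inter> cis -` A)"

lemma angles_fmeasurable:
  assumes "A \<in> sets borel"
  shows "{0..<2*pi} \<inter> cis -` A \<in> fmeasurable lborel"
proof -
  have "cis \<in> borel_measurable borel"
    by (intro borel_measurable_continuous_onI continuous_intros)
  from measurable_sets[OF this assms] have *: "cis -` A \<in> sets lborel"
    by simp
  have "{0..<2*pi} \<in> fmeasurable lborel"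
    by (simp add: fmeasurable_def)
  from fmeasurable_Int_fmeasurable[OF this *] show ?thesis .
qed

lemma circle_measure_mono:
  assumes "A \<subseteq> B" "A \<in> sets borel" "B \<in> sets borel"
  shows "circle_measure A \<le> circle_measure B"
  unfolding circle_measure_def
  using assms angles_fmeasurable[of A] angles_fmeasurable[of B]
  by (intro measure_mono_fmeasurable) (auto simp: fmeasurable_def)

lemma circle_measure_Un_le:
  assumes "A \<in> sets borel" "B \<in> sets borel"
  shows "circle_measure (A \<union> B) \<le> circle_measure A + circle_measure B"
proof -
  have "{0..<2*pi} \<inter> cis -` (A \<union> B) = ({0..<2*pi} \<inter> cis -` A) \<union> ({0..<2*pi} \<inter> cis -` B)"
    by auto
  then show ?thesis
    unfolding circle_measure_def
    using assms angles_fmeasurable[of A] angles_fmeasurable[of B]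
    by (simp add: measure_Un_le fmeasurable_def)
qed

lemma circle_measure_empty: "circle_measure {} = 0"
  by (simp add: circle_measure_def)

lemma circle_measure_UN_le:
  assumes "finite I" "\<And>i. i \<in> I \<Longrightarrow> A i \<in> sets borel"
  shows "circle_measure (\<Union>i\<in>I. A i) \<le> (\<Sum>i\<in>I. circle_measure (A i))"
  using assms
proof (induction I rule: finite_induct)
  case empty
  then show ?case by (simp add: circle_measure_empty)
next
  case (insert i I)
  have "circle_measure (A i \<union> (\<Union>i\<in>I. A i)) \<le> circle_measure (A i) + circle_measure (\<Union>i\<in>I. A i)"
    using insert by (intro circle_measure_Un_le sets.finite_UN) auto
  with insert show ?case by simp
qed

lemma circle_measure_sphere: "circle_measure (sphere 0 1) = 2 * pi"
  by (simp add: circle_measure_def vimage_def)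

section \<open>Arcs, and the part of the circle inside a disk\<close>

text \<open>For \<open>l < 2*pi\<close>, shifting \<open>a\<close> by full turns to \<open>b\<close>
  in one period leaves the angles of the arc in at most two intervals: one from \<open>b\<close>,
  cut off at \<open>2*pi\<close>, and the wrapped remainder from 0. Their lengths add up to at most
  \<open>l\<close>.\<close>

lemma circle_measure_le_arc:
  assumes "A \<in> sets borel" "A \<inter> sphere 0 1 \<subseteq> cis ` {a..a+l}" "0 \<le> l"
  shows "circle_measure A \<le> l"
proof (cases "l < 2*pi")
  case False
  have "circle_measure A \<le> measure lborel {0..<2*pi}"
    unfolding circle_measure_def using angles_fmeasurable[OF assms(1)]
    by (intro measure_mono_fmeasurable) (auto simp: fmeasurable_def)
  with False show ?thesis by simp
next
  case True
  define b where "b = a - 2*pi*\<lfloor>a/(2*pi)\<rfloor>"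
  have b0: "0 \<le> b"
    using floor_divide_lower[of "2*pi" a] by (simp add: b_def mult.commute)
  have b1: "b < 2*pi"
    using floor_divide_upper[of "2*pi" a] by (simp add: b_def algebra_simps)
  have sub: "{0..<2*pi} \<inter> cis -` A \<subseteq> {b..min (b+l) (2*pi)} \<union> {0..b+l-2*pi}"
  proof
    fix t assume t: "t \<in> {0..<2*pi} \<inter> cis -` A"
    then have "cis t \<in> A \<inter> sphere 0 1" by simp
    with assms(2) obtain u where u: "u \<in> {a..a+l}" "cis t = cis u" by blast
    then have "sin t = sin u \<and> cos t = cos u" by (simp add: complex_eq_iff)
    then obtain k :: int where k: "t = u + 2*pi*k"
      unfolding sin_cos_eq_iff by blast
    define j where "j = k + \<lfloor>a/(2*pi)\<rfloor>"
    have j: "t = b + (u - a) + 2*pi*j"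
      by (simp add: k b_def j_def algebra_simps)
    have "0 \<le> t" "t < 2*pi" "a \<le> u" "u \<le> a + l" using t u by auto
    \<comment> \<open>\<open>j = 0\<close> is the part before the wrap, \<open>j = -1\<close> the
      part after it.\<close>
    then have "2*pi*real_of_int j < 2*pi*1" "2*pi*real_of_int (-2) < 2*pi*real_of_int j"
      using j b0 b1 True by linarith+
    then have "real_of_int j < 1" "real_of_int (-2) < real_of_int j"
      by (simp_all only: mult_less_cancel_left_pos[of "2*pi"] pi_gt_zero mult_pos_pos zero_less_numeral)
    then have "j < 1" "-2 < j" by linarith+
    then have "j = 0 \<or> j = -1" by auto
    then show "t \<in> {b..min (b+l) (2*pi)} \<union> {0..b+l-2*pi}"
      using j t u by auto
  qed
  have "circle_measure A \<le> measure lborel ({b..min (b+l) (2*pi)} \<union> {0..b+l-2*pi})"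
    unfolding circle_measure_def using angles_fmeasurable[OF assms(1)] sub
    by (intro measure_mono_fmeasurable fmeasurable.Un fmeasurableI)
      (auto simp: fmeasurable_def emeasure_lborel_Icc_eq)
  also have "\<dots> \<le> measure lborel {b..min (b+l) (2*pi)} + measure lborel {0..b+l-2*pi}"
    by (intro measure_Un_le) auto
  also have "\<dots> \<le> l"
    using b0 b1 True assms(3) by (auto simp: content_real_if min_def)
  finally show ?thesis .
qed

text \<open>The hypothesis on \<open>r\<close> is the law of cosines: the points of the circle at angle \<open>\<delta>\<close> from the
  direction of the centre of the disk have distance at least \<open>r\<close> from that centre.\<close>

lemma cball_circle_subset_arc:
  assumes c: "0 < c" and d: "0 \<le> \<delta>" "\<delta> \<le> pi"
    and r: "2 * c * cos \<delta> \<le> 1 + c\<^sup>2 - r\<^sup>2"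
  shows "cball (of_real c * cis \<phi>) r \<inter> sphere 0 1 \<subseteq> cis ` {\<phi> - \<delta>..(\<phi> - \<delta>) + 2 * \<delta>}"
proof
  fix z assume z: "z \<in> cball (of_real c * cis \<phi>) r \<inter> sphere 0 1"
  define \<theta> where "\<theta> = Arg (z / cis \<phi>)"
  have "norm (z / cis \<phi>) = 1" using z by (simp add: norm_divide)
  then have "cis \<theta> = z / cis \<phi>"
    unfolding \<theta>_def by (metis cis_Arg norm_zero sgn_eq div_by_1 of_real_1 zero_neq_one)
  then have zc: "z = cis (\<phi> + \<theta>)" by (simp add: cis_mult[symmetric])
  have th: "- pi < \<theta>" "\<theta> \<le> pi"
    unfolding \<theta>_def using Arg_bounded by auto
  have "of_real c * cis \<phi> - z = cis \<phi> * (of_real c - cis \<theta>)"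
    by (simp add: zc cis_mult[symmetric] algebra_simps)
  then have "(dist (of_real c * cis \<phi>) z)\<^sup>2 = (norm (of_real c - cis \<theta>))\<^sup>2"
    by (simp add: dist_norm norm_mult)
  also have "\<dots> = (c - cos \<theta>)\<^sup>2 + (sin \<theta>)\<^sup>2"
    by (simp add: cmod_power2)
  also have "\<dots> = c\<^sup>2 - 2*c*cos \<theta> + ((cos \<theta>)\<^sup>2 + (sin \<theta>)\<^sup>2)"
    by (simp add: power2_eq_square algebra_simps)
  finally have "(dist (of_real c * cis \<phi>) z)\<^sup>2 = c\<^sup>2 - 2*c*cos \<theta> + 1" by simp
  moreover have "(dist (of_real c * cis \<phi>) z)\<^sup>2 \<le> r\<^sup>2"
    using z by (intro power_mono) auto
  ultimately have "2*c*cos \<delta> \<le> 2*c*cos \<theta>" using r by linarith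
  then have "cos \<delta> \<le> cos \<bar>\<theta>\<bar>" using c by simp
  then have "\<bar>\<theta>\<bar> \<le> \<delta>"
    using th d cos_mono_le_eq[of \<delta> "\<bar>\<theta>\<bar>"] by auto
  then show "z \<in> cis ` {\<phi> - \<delta>..(\<phi> - \<delta>) + 2 * \<delta>}"
    unfolding zc by (intro imageI) auto
qed

text \<open>The extreme position has a diameter of the disk as a chord of the circle, so
  \<open>norm p = sqrt (1 - r\<^sup>2)\<close>. For other centres, the square of the difference of
  these two numbers being nonnegative is exactly the law of cosines hypothesis.\<close>

lemma circle_measure_cball_le:
  assumes "0 \<le> r" "r < 1"
  shows "circle_measure (cball p r) \<le> 2 * arcsin r"
proof -
  have as: "0 \<le> arcsin r" "arcsin r \<le> pi"
    using arcsin_nonneg[of r] arcsin_bounded[of r] assms by auto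
  have "\<exists>a. cball p r \<inter> sphere 0 1 \<subseteq> cis ` {a..a + 2 * arcsin r}"
  proof (cases "p = 0")
    case True
    then show ?thesis using assms by auto
  next
    case False
    have "0 \<le> (norm p - sqrt (1 - r\<^sup>2))\<^sup>2" by simp
    also have "\<dots> = (norm p)\<^sup>2 - 2 * norm p * sqrt (1 - r\<^sup>2) + (1 - r\<^sup>2)"
      using assms by (simp add: power2_diff abs_square_le_1)
    finally have "2 * norm p * cos (arcsin r) \<le> 1 + (norm p)\<^sup>2 - r\<^sup>2"
      using assms by (simp add: cos_arcsin)
    from cball_circle_subset_arc[OF _ as this, of "Arg p"] False show ?thesis
      unfolding rcis_cmod_Arg[of p, unfolded rcis_def] by (intro exI[of _ "Arg p - arcsin r"]) simp
  qed
  then show ?thesis using as by (auto intro: circle_measure_le_arc)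
qed

text \<open>A chord of length \<open>r\<close> subtends the angle
  \<open>2 * arcsin (r / 2)\<close>.\<close>

lemma circle_measure_cball_sphere_le:
  assumes "norm p = 1" "0 \<le> r" "r \<le> 2"
  shows "circle_measure (cball p r) \<le> 4 * arcsin (r / 2)"
proof -
  have as: "0 \<le> 2 * arcsin (r/2)" "2 * arcsin (r/2) \<le> pi"
    using arcsin_nonneg[of "r/2"] arcsin_bounded[of "r/2"] assms by auto
  have "cos (2 * arcsin (r/2)) = 1 - r\<^sup>2 / 2"
    using assms by (simp add: cos_double_sin power_divide)
  then have "2 * 1 * cos (2 * arcsin (r/2)) \<le> 1 + 1\<^sup>2 - r\<^sup>2"
    by simp
  from cball_circle_subset_arc[OF _ as this, of "Arg p"] assms
  have "cball p r \<inter> sphere 0 1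
      \<subseteq> cis ` {(Arg p - 2 * arcsin (r/2))..(Arg p - 2 * arcsin (r/2)) + 2 * (2 * arcsin (r/2))}"
    using rcis_cmod_Arg[of p] by (simp add: rcis_def)
  from circle_measure_le_arc[OF _ this] as show ?thesis by simp
qed

section \<open>Length explored at speed at most 1\<close>

lemma borel_lipschitz_image:
  fixes f :: "real \<Rightarrow> complex"
  assumes "L-lipschitz_on {c..d} f"
  shows "f ` {c..d} \<in> sets borel"
  using compact_continuous_image[OF lipschitz_on_continuous_on[OF assms]]
  by (auto intro: borel_compact)

text \<open>During a time interval of length \<open>2 * h\<close> the robot stays within
  \<open>h\<close> of its position at the midpoint.\<close>

lemma circle_measure_lipschitz_subdivision:
  fixes f :: "real \<Rightarrow> complex"
  assumes "0 \<le> h" "h < 1" "1-lipschitz_on {c..c + 2 * h * real N} f"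
  shows "circle_measure (f ` {c..c + 2 * h * real N}) \<le> 2 * arcsin h * real N"
  using assms(3)
proof (induction N)
  case 0
  then show ?case using circle_measure_cball_le[of 0 "f c"] by simp
next
  case (Suc N)
  define m where "m = c + 2 * h * real N"
  have m: "c \<le> m" "c + 2 * h * real (Suc N) = m + 2 * h"
    using assms(1) by (auto simp: m_def algebra_simps)
  have lip: "1-lipschitz_on {c..m + 2 * h} f" using Suc.prems m by simp
  have sub: "1-lipschitz_on {c..m} f" "1-lipschitz_on {m..m + 2 * h} f"
    using lip assms(1) m by (auto intro: lipschitz_on_subset)
  have "f ` {m..m + 2 * h} \<subseteq> cball (f (m + h)) h"
  proof
    fix y assume "y \<in> f ` {m..m + 2 * h}"
    then obtain t where t: "t \<in> {m..m + 2 * h}" "y = f t" by blast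
    have "dist (f (m + h)) (f t) \<le> 1 * dist (m + h) t"
      using t assms(1) by (intro lipschitz_onD[OF sub(2)]) auto
    also have "\<dots> \<le> h" using t by (auto simp: dist_real_def)
    finally show "y \<in> cball (f (m + h)) h" using t by simp
  qed
  then have "circle_measure (f ` {m..m + 2 * h}) \<le> circle_measure (cball (f (m + h)) h)"
    using borel_lipschitz_image[OF sub(2)] by (intro circle_measure_mono) auto
  also have "\<dots> \<le> 2 * arcsin h" using assms by (intro circle_measure_cball_le) auto
  finally have last: "circle_measure (f ` {m..m + 2 * h}) \<le> 2 * arcsin h" .
  have "{c..m + 2 * h} = {c..m} \<union> {m..m + 2 * h}"
    using m assms(1) by auto
  then have "circle_measure (f ` {c..m + 2 * h}) = circle_measure (f ` {c..m} \<union> f ` {m..m + 2 * h})"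
    by (simp add: image_Un)
  also have "\<dots> \<le> circle_measure (f ` {c..m}) + circle_measure (f ` {m..m + 2 * h})"
    using sub by (intro circle_measure_Un_le borel_lipschitz_image)
  also have "\<dots> \<le> 2 * arcsin h * real N + 2 * arcsin h"
    using Suc.IH sub(1) last by (simp add: m_def)
  finally show ?case unfolding m by (simp add: algebra_simps)
qed

lemma circle_measure_lipschitz_image_le:
  fixes f :: "real \<Rightarrow> complex"
  assumes "c \<le> d" "1-lipschitz_on {c..d} f"
  shows "circle_measure (f ` {c..d}) \<le> d - c"
proof (cases "c = d")
  case True
  then show ?thesis using circle_measure_cball_le[of 0 "f c"] by simp
next
  case False
  define l where "l = d - c"
  have l: "0 < l" "d = c + l" using False assms by (auto simp: l_def)
  \<comment> \<open>This is \<open>2 * N * arcsin (l / (2 * N))\<close>, with \<open>arcsin\<close>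
    expressed through \<open>arctan\<close> for \<open>real_asymp\<close>.\<close>
  have lim: "(\<lambda>N. 2 * arctan ((l / (2 * real N)) / sqrt (1 - (l / (2 * real N))\<^sup>2)) * real N)
      \<longlonglongrightarrow> l"
    using l(1) by real_asymp
  have "\<forall>\<^sub>F N in sequentially. l / (2 * real N) < 1" using l(1) by real_asymp
  then have "\<forall>\<^sub>F N in sequentially. circle_measure (f ` {c..d})
      \<le> 2 * arctan ((l / (2 * real N)) / sqrt (1 - (l / (2 * real N))\<^sup>2)) * real N"
    using eventually_gt_at_top[of 0]
  proof eventually_elim
    case (elim N)
    define h where "h = l / (2 * real N)"
    have h: "0 \<le> h" "h < 1" "d = c + 2 * h * real N"
      using elim l by (auto simp: h_def)
    have "circle_measure (f ` {c..d}) \<le> 2 * arcsin h * real N"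
      using circle_measure_lipschitz_subdivision[OF h(1,2), of c N f] h(3) assms(2) by simp
    also have "arcsin h = arctan (h / sqrt (1 - h\<^sup>2))"
      using h by (intro arcsin_arctan) auto
    finally show ?case by (simp add: h_def)
  qed
  from tendsto_lowerbound[OF lim this] show ?thesis by (simp add: l_def)
qed

section \<open>Covering argument\<close>

text \<open>Discovery happens at some \<open>s\<close> with \<open>t \<le> s\<close>, and between
  \<open>t\<close> and \<open>s\<close> the queen gets closer to \<open>y\<close> by at most
  \<open>s - t\<close>.\<close>

lemma arrival_time_ge:
  assumes "solves_PE n queen servant" "y \<in> sphere 0 1" "0 \<le> t"
    and unvisited: "\<And>s. s < t \<Longrightarrow> \<not> visited_at n queen servant s y"
  shows "t + dist (queen t) y \<le> queen_arrival_time n queen servant y"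
proof -
  define s where "s = discovery_time n queen servant y"
  have "{t. visited_at n queen servant t y} \<noteq> {}"
    using assms(1,2) unfolding solves_PE_def by blast
  then have s: "t \<le> s"
    unfolding s_def discovery_time_def
    using unvisited by (intro cInf_greatest) (auto simp: not_less[symmetric])
  have "1-lipschitz_on {0..} queen"
    using assms(1) by (simp add: solves_PE_def trajectory_def)
  then have "dist (queen t) (queen s) \<le> 1 * dist t s"
    using assms(3) s by (intro lipschitz_onD) auto
  moreover have "dist (queen t) y \<le> dist (queen t) (queen s) + dist (queen s) y"
    by (rule dist_triangle)
  ultimately show ?thesis
    using s by (simp add: queen_arrival_time_def Let_def s_def[symmetric] dist_real_def)
qed

lemma trajectory_norm_le:
  assumes "trajectory f" "0 \<le> t"
  shows "norm (f t) \<le> t"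
proof -
  have "dist (f t) (f 0) \<le> 1 * dist t 0"
    using assms by (intro lipschitz_onD[of 1 "{0..}"]) (auto simp: trajectory_def)
  with assms show ?thesis by (simp add: trajectory_def dist_norm)
qed

text \<open>The condition \<open>inside\<close> stops short of time \<open>1 + x\<close>, so the
  queen may be on the circle at that moment; both cases of the final argument are thus
  covered.\<close>

lemma covering_inequality:
  assumes solves: "solves_PE n queen servant"
    and arrival: "\<And>y. y \<in> sphere 0 1 \<Longrightarrow> queen_arrival_time n queen servant y \<le> T"
    and x: "0 \<le> x"
    and inside: "\<And>t. 0 \<le> t \<Longrightarrow> t < 1 + x \<Longrightarrow> norm (queen t) \<noteq> 1"
  shows "2 * pi \<le> real n * x + circle_measure (cball (queen (1 + x)) (T - 1 - x))"
proof -
  define E where "E i = servant i ` {1..1 + x}" for i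
  define B where "B = cball (queen (1 + x)) (T - 1 - x)"
  have traj: "trajectory (servant i)" if "i < n" for i
    using solves that by (simp add: solves_PE_def)
  have lip: "1-lipschitz_on {1..1 + x} (servant i)" if "i < n" for i
    using traj[OF that] by (auto simp: trajectory_def intro: lipschitz_on_subset)
  have E: "E i \<in> sets borel" if "i < n" for i
    unfolding E_def by (rule borel_lipschitz_image[OF lip[OF that]])
  then have UE: "(\<Union>i<n. E i) \<in> sets borel" by (intro sets.finite_UN) auto
  have "sphere 0 1 \<subseteq> (\<Union>i<n. E i) \<union> B"
  proof
    fix y :: complex assume y: "y \<in> sphere 0 1"
    show "y \<in> (\<Union>i<n. E i) \<union> B"
    proof (cases "\<exists>s<1 + x. visited_at n queen servant s y")
      case True
      then obtain s where s: "s < 1 + x" "visited_at n queen servant s y" by blast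
      moreover have "\<not> visits queen s y"
        using inside[of s] s(1) y by (auto simp: visits_def)
      ultimately obtain i where i: "i < n" "0 \<le> s" "servant i s = y"
        by (auto simp: visited_at_def visits_def)
      \<comment> \<open>Reaching the circle from the centre takes time at least 1.\<close>
      then have "1 \<le> s" using trajectory_norm_le[OF traj, of i s] y by auto
      then have "y \<in> E i" using i s(1) by (auto simp: E_def)
      with i(1) show ?thesis by blast
    next
      case False
      then have "1 + x + dist (queen (1 + x)) y \<le> queen_arrival_time n queen servant y"
        using x by (intro arrival_time_ge[OF solves y]) auto
      with arrival[OF y] show ?thesis by (simp add: B_def)
    qed
  qed
  then have "2 * pi \<le> circle_measure ((\<Union>i<n. E i) \<union> B)"
    unfolding circle_measure_sphere[symmetric]
    using UE by (intro circle_measure_mono) (auto simp: B_def)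
  also have "\<dots> \<le> circle_measure (\<Union>i<n. E i) + circle_measure B"
    using UE by (intro circle_measure_Un_le) (auto simp: B_def)
  also have "circle_measure (\<Union>i<n. E i) \<le> (\<Sum>i<n. circle_measure (E i))"
    using E by (intro circle_measure_UN_le) auto
  also have "\<dots> \<le> (\<Sum>i<n. x)"
    using lip x circle_measure_lipschitz_image_le[of 1 "1 + x"] by (intro sum_mono) (auto simp: E_def)
  finally show ?thesis by (simp add: B_def)
qed

section \<open>Trigonometric estimates\<close>

text \<open>With \<open>s = 2 / n\<close> this is the comparison at \<open>x = 0\<close>. The two
  summands are at most \<open>pi / 3 - \<delta> / 2\<close> and
  \<open>sqrt 3 / 2 + \<delta> / 2\<close>, so \<open>\<delta>\<close> cancels.\<close>

lemma mult_arccos_plus_sqrt_le_2: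
  fixes s :: real
  assumes "0 \<le> s" "s \<le> 1 / 2"
  shows "s * arccos (- s) + sqrt (1 - s\<^sup>2) \<le> 2"
proof -
  define \<delta> where "\<delta> = 2 * pi / 3 - arccos (- s)"
  have a: "arccos (- s) = 2 * pi / 3 - \<delta>" by (simp add: \<delta>_def)
  have "arccos (- s) \<le> arccos (- (1 / 2))" "0 \<le> arccos (- s)"
    using assms by (intro arccos_le_arccos arccos_lbound; simp)+
  moreover have "arccos (- (1 / 2)) = 2 * pi / 3"
    by (subst arccos_minus) auto
  ultimately have d: "0 \<le> \<delta>" by (simp add: \<delta>_def)
  have "sqrt (1 - s\<^sup>2) = sin (arccos (- s))"
    using assms by (simp add: sin_arccos)
  also have "\<dots> = sqrt 3 / 2 * cos \<delta> + sin \<delta> / 2"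
    \<comment> \<open>compare with the worst case \<open>s = 1/2\<close>, where the angle is \<open>2 \<pi> / 3\<close>\<close>
    unfolding a sin_diff by (simp add: sin_120 cos_120)
  also have "\<dots> \<le> sqrt 3 / 2 * 1 + \<delta> / 2"
    using sin_x_le_x[OF d] by (intro add_mono mult_left_mono) auto
  finally have "sqrt (1 - s\<^sup>2) \<le> sqrt 3 / 2 + \<delta> / 2" by simp
  moreover have "s * arccos (- s) \<le> 1 / 2 * arccos (- s)"
    using assms \<open>0 \<le> arccos (- s)\<close> by (intro mult_right_mono) auto
  \<comment> \<open>The constants suffice because \<open>1.8 / 2 + 3.3 / 3 = 2\<close>.\<close>
  moreover have "sqrt 3 \<le> 1.8" by (rule real_le_lsqrt) (auto simp: power2_eq_square)
  moreover have "pi < 3.3" using pi_approx by simp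
  ultimately show ?thesis using a by simp
qed

lemma concave_on_cos: "concave_on {0..pi/2} cos"
proof (rule f''_le0_imp_concave)
  show "(cos has_real_derivative - sin x) (at x)" for x :: real
    by (auto intro!: derivative_eq_intros)
  show "((\<lambda>x. - sin x) has_real_derivative - cos x) (at x)" for x :: real
    by (auto intro!: derivative_eq_intros)
qed (auto intro: cos_ge_zero)

lemma servant_arc_bound_le:
  fixes n :: real
  assumes n: "0 < n" and a: "0 < a" "a \<le> pi" and le2: "2 / n * a + sin a \<le> 2"
    and x: "0 \<le> x" "x \<le> 2 / n * a"
  shows "2 / n * a + sin a \<le> x + 2 * cos (n * x / 4)"
proof -
  \<comment> \<open>\<open>x\<close> as a fraction of its largest value; the argument of the cosine
    becomes \<open>\<mu> * (a / 2)\<close>.\<close>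
  define \<mu> where "\<mu> = n * x / (2 * a)"
  have \<mu>: "0 \<le> \<mu>" "\<mu> \<le> 1" "n * x / 4 = \<mu> * (a / 2)" "x = \<mu> * (2 / n * a)"
    using n a x by (auto simp: \<mu>_def field_simps)
  have "(1 - \<mu>) * cos 0 + \<mu> * cos (a / 2) \<le> cos ((1 - \<mu>) *\<^sub>R 0 + \<mu> *\<^sub>R (a / 2))"
    using concave_on_cos a \<mu>(1,2) by (intro concave_onD) auto
  then have cos: "(1 - \<mu>) + \<mu> * cos (a / 2) \<le> cos (n * x / 4)" by (simp add: \<mu>(3))
  have "sin a = 2 * sin (a / 2) * cos (a / 2)"
    using sin_double[of "a / 2"] by simp
  also have "\<dots> \<le> 2 * 1 * cos (a / 2)"
    using a by (intro mult_right_mono mult_left_mono cos_ge_zero) auto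
  finally have sin: "sin a \<le> 2 * cos (a / 2)" by simp
  define k where "k = 2 / n * a + sin a"
  have "k = (1 - \<mu>) * k + \<mu> * k" by (simp add: algebra_simps)
  also have "\<dots> \<le> (1 - \<mu>) * 2 + \<mu> * (2 / n * a + 2 * cos (a / 2))"
    using \<mu> le2 sin by (intro add_mono mult_left_mono) (auto simp: k_def)
  also have "\<dots> = x + 2 * ((1 - \<mu>) + \<mu> * cos (a / 2))"
    using \<mu>(4) by (simp add: algebra_simps)
  finally show ?thesis using cos by (simp add: k_def)
qed

section \<open>The lower bound\<close>

lemma arrival_time_lower_bound:
  assumes n: "4 \<le> n" and solves: "solves_PE n queen servant"
    and arrival: "\<And>y. y \<in> sphere 0 1 \<Longrightarrow> queen_arrival_time n queen servant y \<le> T"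
  shows "1 + 2 / real n * arccos (- (2 / real n)) + sqrt (1 - 4 / (real n)\<^sup>2) \<le> T"
proof (rule ccontr)
  \<comment> \<open>While the queen is off the circle, covering suggests the bound
    \<open>1 + x + sin (n * x / 2)\<close>. Its derivative vanishes where
    \<open>cos (n * x / 2) = - 2 / n\<close>, that is at \<open>x = X\<close>.\<close>
  define a where "a = arccos (- (2 / real n))"
  define X where "X = 2 / real n * a"
  have s: "0 < 2 / real n" "- 1 < 2 / real n" "2 / real n \<le> 1 / 2" using n by (auto simp: field_simps intro: less_trans[of _ 0])
  have sin_a: "sin a = sqrt (1 - 4 / (real n)\<^sup>2)"
    unfolding a_def by (subst sin_arccos, use s in linarith, use s in linarith) (simp add: power_divide)
  have a: "pi / 2 < a" "a < pi"
    using s less_imp_le[OF s(2)] arccos_less_arccos[of "- (2 / real n)" 0]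
      arccos_less_arccos[of "-1" "- (2 / real n)"]
    by (auto simp: a_def)
  have X: "0 < X" "real n * X = 2 * a" using a n by (auto simp: X_def)
  have le2: "X + sin a \<le> 2"
    using mult_arccos_plus_sqrt_le_2[of "2 / real n"] s
    unfolding X_def sin_a by (simp add: a_def power_divide)
  assume "\<not> ?thesis"
  then have T: "T < 1 + X + sin a" unfolding X_def sin_a by (simp add: a_def)
  have lip: "1-lipschitz_on {0..} queen" and traj: "trajectory queen"
    using solves by (auto simp: solves_PE_def trajectory_def)
  show False
  proof (cases "\<exists>t\<in>{0..1 + X}. norm (queen t) = 1")
    case False
    define r where "r = T - 1 - X"
    have cov: "2 * pi \<le> real n * X + circle_measure (cball (queen (1 + X)) r)"
      unfolding r_def using False X by (intro covering_inequality[OF solves arrival]) auto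
    show False
    \<comment> \<open>A negative radius gives an empty disk, and the servants alone cover only
      \<open>2 * a < 2 * pi\<close>.\<close>
    proof (cases "r < 0")
      case True
      then show False using cov X a by (simp add: circle_measure_empty)
    next
      case rnn: False
      have "sin a < 1"
        using a sin_monotone_2pi[of "pi - a" "pi / 2"] by simp
      then have "circle_measure (cball (queen (1 + X)) r) \<le> 2 * arcsin r"
        using rnn T by (intro circle_measure_cball_le) (auto simp: r_def)
      \<comment> \<open>As \<open>a\<close> is obtuse, \<open>arcsin\<close> inverts the sine at
        \<open>pi - a\<close>. The total stays strictly below
        \<open>2 * a + 2 * (pi - a) = 2 * pi\<close>.\<close>
      also have "arcsin r < arcsin (sin (pi - a))"
        using rnn T \<open>sin a < 1\<close> by (intro arcsin_less_arcsin) (auto simp: r_def)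
      also have "\<dots> = pi - a" using a by (intro arcsin_sin) auto
      finally show False using cov X by simp
    qed
  next
    case True
    \<comment> \<open>Compactness of \<open>K\<close> provides the first time at which the queen is
      on the circle.\<close>
    define K where "K = {t\<in>{0..1 + X}. norm (queen t) = 1}"
    have "continuous_on {0..1 + X} (\<lambda>t. norm (queen t))"
      by (intro continuous_on_norm lipschitz_on_continuous_on[OF lipschitz_on_subset[OF lip]]) auto
    then have "closed K" unfolding K_def
      by (intro continuous_closed_preimage_constant) auto
    moreover have "bounded K" by (rule bounded_subset[of "{0..1 + X}"]) (auto simp: K_def)
    ultimately have "compact K" by (simp add: compact_eq_bounded_closed)
    moreover have "K \<noteq> {}" using True by (auto simp: K_def)
    ultimately have "\<exists>t\<in>K. \<forall>u\<in>K. t \<le> u" by (rule compact_attains_inf)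
    then obtain t where t: "t \<in> K" "\<And>u. u \<in> K \<Longrightarrow> t \<le> u"
      by blast
    define x where "x = t - 1"
    define r where "r = T - 1 - x"
    have "1 \<le> t" using trajectory_norm_le[OF traj, of t] t by (auto simp: K_def)
    then have x: "0 \<le> x" "x \<le> X" "norm (queen (1 + x)) = 1"
      using t by (auto simp: x_def K_def)
    have "norm (queen u) \<noteq> 1" if "0 \<le> u" "u < 1 + x" for u
      using that t(2)[of u] x by (force simp: K_def x_def)
    then have cov: "2 * pi \<le> real n * x + circle_measure (cball (queen (1 + x)) r)"
      unfolding r_def using x by (intro covering_inequality[OF solves arrival]) auto
    have nx: "real n * x \<le> 2 * a"
      using mult_left_mono[OF x(2), of "real n"] X by simp
    show False
    proof (cases "r < 0")
      case True
      then show False using cov nx a by (simp add: circle_measure_empty)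
    next
      case rnn: False
      have r2: "r \<le> 2" using T le2 x by (simp add: r_def)
      have "circle_measure (cball (queen (1 + x)) r) \<le> 4 * arcsin (r / 2)"
        using rnn r2 x by (intro circle_measure_cball_sphere_le) auto
      with cov have "pi / 2 - real n * x / 4 \<le> arcsin (r / 2)" by simp
      then have "sin (pi / 2 - real n * x / 4) \<le> sin (arcsin (r / 2))"
        using x nx a rnn r2 arcsin_bounded[of "r / 2"]
        by (intro sin_monotone_2pi_le) auto
      then have "2 * cos (real n * x / 4) \<le> r"
        using rnn r2 by (simp add: sin_diff)
      moreover have "X + sin a \<le> x + 2 * cos (real n * x / 4)"
        unfolding X_def using n a x le2 by (intro servant_arc_bound_le) (auto simp: X_def)
      ultimately show False using T by (simp add: r_def)
    qed
  qed
qed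

text \<open>The supremum is an extended real, so it is compared through its real upper bounds
  \<open>T\<close>.\<close>

lemma evacuation_time_lower_bound:
  assumes "4 \<le> n" "solves_PE n queen servant"
  shows "ereal (1 + 2 / real n * arccos (- (2 / real n)) + sqrt (1 - 4 / (real n)\<^sup>2))
           \<le> evacuation_time n queen servant"
proof (rule ereal_le_real)
  fix T assume "evacuation_time n queen servant \<le> ereal T"
  then have "queen_arrival_time n queen servant y \<le> T" if "y \<in> sphere 0 1" for y
    using that by (auto simp: evacuation_time_def SUP_le_iff)
  from arrival_time_lower_bound[OF assms this]
  show "ereal (1 + 2 / real n * arccos (- (2 / real n)) + sqrt (1 - 4 / (real n)\<^sup>2)) \<le> ereal T"
    by simp
qed

section \<open>Asymptotic expansion\<close>

text \<open>Since \<open>arccos (- s) = pi / 2 + arcsin s\<close>, the second-order terms are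
  \<open>4 / n^2\<close> from the arc cosine and \<open>- 2 / n^2\<close> from the root.\<close>

lemma bound_asymptotics:
  "(\<lambda>n::nat. (1 + 2 / real n * arccos (- (2 / real n)) + sqrt (1 - 4 / (real n)\<^sup>2))
              - (2 + pi / real n + 2 / (real n)\<^sup>2)) \<in> O(\<lambda>n. 1 / real n ^ 3)"
proof -
  have "(\<lambda>n::nat. (1 + 2 / real n * (pi / 2 + arctan ((2 / real n) / sqrt (1 - (2 / real n)\<^sup>2)))
              + sqrt (1 - 4 / (real n)\<^sup>2))
              - (2 + pi / real n + 2 / (real n)\<^sup>2)) \<in> O(\<lambda>n. 1 / real n ^ 3)"
    by real_asymp
  moreover have "\<forall>\<^sub>F n::nat in sequentially.
      arccos (- (2 / real n)) = pi / 2 + arctan ((2 / real n) / sqrt (1 - (2 / real n)\<^sup>2))"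
    using eventually_gt_at_top[of 2]
  proof eventually_elim
    case (elim n)
    then have "2 / real n < 1" "-1 < 2 / real n"
      by (auto simp: field_simps intro: less_trans[of _ 0])
    then show ?case
      using arcsin_minus[of "2 / real n"] arcsin_arctan[of "2 / real n"]
        arccos_arcsin_eq[of "- (2 / real n)"] by simp
  qed
  ultimately show ?thesis
    by (subst landau_o.big.in_cong) (auto elim: eventually_mono)
qed

theorem theorem2:
  shows "(\<forall>n\<ge>4. \<forall>queen servant. solves_PE n queen servant \<longrightarrow>
            ereal (1 + 2 / real n * arccos (- (2 / real n)) + sqrt (1 - 4 / (real n)\<^sup>2))
              \<le> evacuation_time n queen servant) \<and>
         (\<lambda>n::nat. (1 + 2 / real n * arccos (- (2 / real n)) + sqrt (1 - 4 / (real n)\<^sup>2))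
                    - (2 + pi / real n + 2 / (real n)\<^sup>2)) \<in> O(\<lambda>n. 1 / real n ^ 3)"
  using evacuation_time_lower_bound bound_asymptotics by blast

end
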